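(* Let $n\ge 1$ and let $$\mathbf{S}_1=(S_1,\ldots,S_{k_1}),\ \mathbf{S}_2=(S_{k_1+1},\ldots,S_{k_1+k_2}),\ \ldots,\ \mathbf{S}_l=(S_{k_1+\cdots+k_{l-1}+1},\ldots,S_{k_1+\cdots+k_l})$$ be ordered set partitions of pairwise disjoint sets $J_1,\ldots,J_l$ with $S_1\sqcup\cdots\sqcup S_m=\{1,\ldots,n\}$, where $m=k_1+\cdots+k_l$. Then, as functions on $\mathbb{R}^n$ (in particular in $\hat{\mathcal{P}}^n$), $$[[\mathbf{S}_1]]\bullet\cdots\bullet[[\mathbf{S}_l]]=\sum_{\pi}(-1)^{m-\operatorname{len}(\pi)}\,[\pi],$$ where the left side is the characteristic function of the Minkowski sum $[\mathbf{S}_1]+\cdots+[\mathbf{S}_l]$ of the plates, and $\pi$ ranges over all shuffle-lumpings of $\mathbf{S}_1,\ldots,\mathbf{S}_l$, $[\pi]$ denoting the characteristic function of the plate labelled by $\pi$.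
   Context: $V_0^n=\{x\in\mathbb{R}^n:\sum x_i=0\}$, $x_S=\sum_{i\in S}x_i$. An ordered set partition of a set $J$ is a sequence of nonempty pairwise disjoint subsets with union $J$; $\operatorname{len}$ is its number of blocks. For an ordered set partition $(T_1,\ldots,T_k)$ of $J\subseteq\{1,\ldots,n\}$, the plate $[T_1,\ldots,T_k]$ is $\{x\in\mathbb{R}^n: x_j=0 \text{ for } j\notin J,\ x_{T_1\cup\cdots\cup T_i}\ge 0\ (i=1,\ldots,k-1),\ x_J=0\}$, and $[[T_1,\ldots,T_k]]$ is its characteristic function. $\hat{\mathcal{P}}^n$ is the complex span of characteristic functions of plates labelled by ordered set partitions of $\{1,\ldots,n\}$. For characteristic functions of cones, $[C_1]\bullet[C_2]$ is the characteristic function of the Minkowski sum $C_1+C_2=\{u+v:u\in C_1,v\in C_2\}$. An ordered set partition $\mathbf{T}=(T_1,\ldots,T_r)$ of $\{1,\ldots,n\}$ is a shuffle-lumping of $\mathbf{S}_1,\ldots,\mathbf{S}_l$ if each block $T_a$ is a union of some of the sets $S_1,\ldots,S_m$, and, writing $p_i$ for the index of the block of $\mathbf{T}$ containing $S_i$, one has $p_i<p_{i+1}$ whenever $S_i$ and $S_{i+1}$ are consecutive blocks of the same $\mathbf{S}_j$ (i.e. $p_1<\cdots<p_{k_1}$, $p_{k_1+1}<\cdots<p_{k_1+k_2}$, etc.). *)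

theory Defs
  imports
    "HOL-Analysis.Analysis"
    "HOL-Library.Set_Algebras"
    "HOL-Library.Function_Algebras"
    "HOL-Library.Disjoint_Sets"
begin

text \<open>
  The ground set $\{1,\ldots,n\}$ is a nonempty finite type \<open>'n\<close>, and $\mathbb{R}^n$
  is \<open>real ^ 'n\<close>.  Addition of sets (\<open>+\<close>, \<open>\<Sum>\<close>) is the Minkowski sum of
  \<open>Set_Algebras\<close>.
\<close>

definition ordered_set_partition :: "'a set \<Rightarrow> 'a set list \<Rightarrow> bool" where
  "ordered_set_partition J T \<longleftrightarrow> distinct T \<and> partition_on J (set T)"

definition coord_sum :: "real ^ 'n \<Rightarrow> 'n::finite set \<Rightarrow> real" where
  "coord_sum x A = (\<Sum>j\<in>A. x $ j)"

text \<open>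
  The underlying set $J$ of $(T_1,\ldots,T_k)$ is \<open>\<Union>(set T)\<close>, and
  $T_1\cup\cdots\cup T_i$ is \<open>\<Union>(set (take i T))\<close>.
\<close>

definition plate :: "'n::finite set list \<Rightarrow> (real ^ 'n) set" where
  "plate T = {x. (\<forall>j. j \<notin> \<Union>(set T) \<longrightarrow> x $ j = 0) \<and>
                 (\<forall>i\<in>{1..<length T}. coord_sum x (\<Union>(set (take i T))) \<ge> 0) \<and>
                 coord_sum x (\<Union>(set T)) = 0}"

definition plate_fun :: "'n::finite set list \<Rightarrow> real ^ 'n \<Rightarrow> complex" where
  "plate_fun T = indicator (plate T)"

text \<open>The space $\hat{\mathcal{P}}^n$, as a complex linear span of functions on $\mathbb{R}^n$.\<close>

definition plate_space :: "(real ^ 'n::finite \<Rightarrow> complex) set" where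
  "plate_space =
     module.span (\<lambda>c f x. c * f x) (plate_fun ` {T. ordered_set_partition UNIV T})"

text \<open>
  The index of the block of \<open>T\<close> containing \<open>A\<close>; indices start at 0, which does not
  affect comparisons between them.
\<close>

definition block_index :: "'a set list \<Rightarrow> 'a set \<Rightarrow> nat" where
  "block_index T A = (THE a. a < length T \<and> A \<subseteq> T ! a)"

text \<open>
  \<open>S 1, \<dots>, S l\<close> are the ordered set partitions
  $\mathbf{S}_1,\ldots,\mathbf{S}_l$; the sets $S_1,\ldots,S_m$ are the members of
  \<open>\<Union>j\<in>{1..l}. set (S j)\<close>.
\<close>

definition shuffle_lumping ::
    "nat \<Rightarrow> (nat \<Rightarrow> 'n::finite set list) \<Rightarrow> 'n set list \<Rightarrow> bool" where
  "shuffle_lumping l S T \<longleftrightarrow>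
     ordered_set_partition UNIV T \<and>
     (\<forall>A\<in>set T. \<exists>F. F \<subseteq> (\<Union>j\<in>{1..l}. set (S j)) \<and> A = \<Union>F) \<and>
     (\<forall>j\<in>{1..l}. \<forall>i. Suc i < length (S j) \<longrightarrow>
        block_index T (S j ! i) < block_index T (S j ! Suc i))"

text \<open>
  The two facts below justify a sum over all shuffle-lumpings with sign
  \<open>(- 1) ^ (m - length T)\<close>: the range is finite and the subtraction does not truncate.
\<close>

lemma finite_shuffle_lumpings: "finite {T. shuffle_lumping l S T}"
proof (rule finite_subset)
  show "{T. shuffle_lumping l S T} \<subseteq> {T. set T \<subseteq> UNIV \<and> distinct T}"
    by (auto simp: shuffle_lumping_def ordered_set_partition_def)
  show "finite {T :: 'n::finite set list. set T \<subseteq> UNIV \<and> distinct T}"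
    by (rule finite_subset_distinct) simp
qed

lemma shuffle_lumping_length_le:
  assumes "shuffle_lumping l S T"
  shows "length T \<le> (\<Sum>j=1..l. length (S j))"
proof -
  let ?B = "\<Union>j\<in>{1..l}. set (S j)"
  have T: "distinct T" "{} \<notin> set T" "disjoint (set T)"
    and lump: "\<And>A. A \<in> set T \<Longrightarrow> \<exists>F. F \<subseteq> ?B \<and> A = \<Union>F"
    using assms by (auto simp: shuffle_lumping_def ordered_set_partition_def partition_on_def)
  have "\<exists>C. C \<in> ?B \<and> C \<noteq> {} \<and> C \<subseteq> A" if A: "A \<in> set T" for A
  proof -
    obtain F where F: "F \<subseteq> ?B" "A = \<Union>F" using lump[OF A] by blast
    have "A \<noteq> {}" using A T(2) by blast
    then obtain C where "C \<in> F" "C \<noteq> {}" using F(2) by blast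
    then show ?thesis using F by blast
  qed
  then obtain g where g: "\<And>A. A \<in> set T \<Longrightarrow> g A \<in> ?B \<and> g A \<noteq> {} \<and> g A \<subseteq> A" by metis
  have "inj_on g (set T)"
  proof (rule inj_onI)
    fix A B assume AB: "A \<in> set T" "B \<in> set T" "g A = g B"
    then have "A \<inter> B \<noteq> {}" using g[OF AB(1)] g[OF AB(2)] by auto
    then show "A = B" using T(3) AB by (meson disjointD)
  qed
  moreover have "g ` set T \<subseteq> ?B" using g by blast
  ultimately have "card (set T) \<le> card ?B" by (intro card_inj_on_le[of g]) auto
  also have "\<dots> \<le> (\<Sum>j=1..l. card (set (S j)))" by (rule card_UN_le) simp
  also have "\<dots> \<le> (\<Sum>j=1..l. length (S j))" by (intro sum_mono card_length)
  finally show ?thesis using T(1) by (simp add: distinct_card)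
qed

end

theory Submission
  imports Defs
begin

text \<open>
  Index the blocks of the $\mathbf{S}_j$ by pairs, ordered as a disjoint union of chains, and put
  $y(q) = x_{S_q}$.  If $x$ has total sum $0$, then $x$ lies in the Minkowski sum iff $y(K) \ge 0$
  for all downsets $K$.  The alternating sum over lumpings all of whose prefixes $K$ satisfy
  $y(K) \ge 0$ is shown to be the indicator of this condition for every finite acyclic relation,
  by induction: splitting off the last block $A$, a set of maximal elements, leaves
  $\sum_A (-1)^{|A|} G(I \setminus A) = 0$ to be proved, where $G$ is the indicator.
  Toggling membership in $A$ of a suitable maximal element of $I$ does not change
  $G(I \setminus A)$, so the terms cancel in pairs.
\<close>

section \<open>Lumpings of a finite set under a relation, and recursion on the last block\<close>

definition maximals :: "('a \<times> 'a) set \<Rightarrow> 'a set \<Rightarrow> 'a set" where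
  "maximals R I = {a \<in> I. \<forall>b\<in>I. (a, b) \<notin> R}"

definition downset :: "('a \<times> 'a) set \<Rightarrow> 'a set \<Rightarrow> 'a set \<Rightarrow> bool" where
  "downset R I K \<longleftrightarrow> K \<subseteq> I \<and> (\<forall>a\<in>I. \<forall>b\<in>K. (a, b) \<in> R \<longrightarrow> a \<in> K)"

text \<open>The case \<open>i = j\<close> is included, so no block contains two
  \<open>R\<close>-related elements. A member amounts to a strictly \<open>R\<close>-increasing map
  from \<open>I\<close> onto an initial segment of the naturals.\<close>

definition compatible_partitions :: "('a \<times> 'a) set \<Rightarrow> 'a set \<Rightarrow> 'a set list set" where
  "compatible_partitions R I =
     {T. ordered_set_partition I T \<and>
         (\<forall>i<length T. \<forall>j<length T. \<forall>a\<in>T ! i. \<forall>b\<in>T ! j. (a, b) \<in> R \<longrightarrow> i < j)}"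

text \<open>The index is unbounded: \<open>i = 0\<close> gives the empty sum, and every
  \<open>i \<ge> length T\<close> tests the whole union. Unlike in \<open>plate\<close>, the total
  is thus only required to be nonnegative, a condition that the recursion on the last block
  preserves.\<close>

definition nonneg_prefixes :: "('a \<Rightarrow> real) \<Rightarrow> 'a set list \<Rightarrow> bool" where
  "nonneg_prefixes y T \<longleftrightarrow> (\<forall>i. sum y (\<Union>(set (take i T))) \<ge> 0)"

definition nonneg_downsets :: "('a \<times> 'a) set \<Rightarrow> ('a \<Rightarrow> real) \<Rightarrow> 'a set \<Rightarrow> bool" where
  "nonneg_downsets R y I \<longleftrightarrow> (\<forall>K. downset R I K \<longrightarrow> sum y K \<ge> 0)"

lemma ordered_set_partition_nth_eq:
  assumes "ordered_set_partition I T" "i < length T" "j < length T" "a \<in> T ! i" "a \<in> T ! j"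
  shows "i = j"
  using assms unfolding ordered_set_partition_def partition_on_def disjoint_def
  by (metis disjoint_iff nth_eq_iff_index_eq nth_mem)

lemma ordered_set_partition_snoc:
  "ordered_set_partition I (T @ [A]) \<longleftrightarrow>
     A \<noteq> {} \<and> A \<subseteq> I \<and> ordered_set_partition (I - A) T"
proof (intro iffI conjI)
  assume *: "ordered_set_partition I (T @ [A])"
  then show "A \<noteq> {}" "A \<subseteq> I"
    by (auto simp: ordered_set_partition_def partition_on_def)
  have "A \<notin> set T" "disjoint (insert A (set T))"
    using * by (auto simp: ordered_set_partition_def partition_on_def)
  then have "B \<inter> A = {}" if "B \<in> set T" for B
    using that by (auto simp: disjoint_def)
  with * show "ordered_set_partition (I - A) T"
    by (auto simp: ordered_set_partition_def partition_on_def disjoint_def)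
next
  assume "A \<noteq> {} \<and> A \<subseteq> I \<and> ordered_set_partition (I - A) T"
  moreover from this have "B \<inter> A = {}" if "B \<in> set T" for B
    using that by (auto simp: ordered_set_partition_def partition_on_def)
  ultimately show "ordered_set_partition I (T @ [A])"
    by (fastforce simp: ordered_set_partition_def partition_on_def disjoint_def)
qed

lemma finite_compatible_partitions:
  assumes "finite I"
  shows "finite (compatible_partitions R I)"
proof (rule finite_subset)
  show "compatible_partitions R I \<subseteq> {T. set T \<subseteq> Pow I \<and> distinct T}"
    by (auto simp: compatible_partitions_def ordered_set_partition_def partition_on_def)
  show "finite {T. set T \<subseteq> Pow I \<and> distinct T}"
    using assms by (intro finite_subset_distinct) simp
qed

text \<open>An \<open>R\<close>-successor of an element of the last block would need a still later
  block, so the last block consists of maximal elements. Conversely, maximal elements may be placed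
  last without violating any constraint.\<close>

lemma snoc_in_compatible_partitions_iff:
  "T @ [A] \<in> compatible_partitions R I \<longleftrightarrow>
     A \<noteq> {} \<and> A \<subseteq> maximals R I \<and> T \<in> compatible_partitions R (I - A)"
proof (intro iffI conjI)
  assume *: "T @ [A] \<in> compatible_partitions R I"
  then have osp: "A \<noteq> {}" "A \<subseteq> I" "ordered_set_partition (I - A) T"
    by (auto simp: compatible_partitions_def ordered_set_partition_snoc)
  have less: "i < j" if "i \<le> length T" "j \<le> length T" "a \<in> (T @ [A]) ! i"
    "b \<in> (T @ [A]) ! j" "(a, b) \<in> R" for i j a b
    using * that by (auto simp: compatible_partitions_def less_Suc_eq_le)
  show "A \<noteq> {}" by fact
  show "A \<subseteq> maximals R I"
  proof
    fix a assume a: "a \<in> A"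
    have "(a, b) \<notin> R" if "b \<in> I" for b
    proof -
      have "b \<in> \<Union>(set (T @ [A]))"
        using that osp by (auto simp: ordered_set_partition_def partition_on_def)
      then obtain j where "j < length (T @ [A])" "b \<in> (T @ [A]) ! j"
        by (metis UnionE in_set_conv_nth)
      then show ?thesis using less[of "length T" j a b] a by auto
    qed
    then show "a \<in> maximals R I" using a osp by (auto simp: maximals_def)
  qed
  have "i < j" if "i < length T" "j < length T" "a \<in> T ! i" "b \<in> T ! j" "(a, b) \<in> R" for i j a b
    using less[of i j a b] that by (simp add: nth_append)
  then show "T \<in> compatible_partitions R (I - A)"
    using osp(3) unfolding compatible_partitions_def by blast
next
  assume *: "A \<noteq> {} \<and> A \<subseteq> maximals R I \<and> T \<in> compatible_partitions R (I - A)"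
  then have "A \<subseteq> I" by (auto simp: maximals_def)
  moreover have "i < j" if ij: "i < length (T @ [A])" "j < length (T @ [A])" 
    "a \<in> (T @ [A]) ! i" "b \<in> (T @ [A]) ! j" "(a, b) \<in> R" for i j a b
  proof -
    have "\<Union>(set T) \<subseteq> I"
      using * by (auto simp: compatible_partitions_def ordered_set_partition_def partition_on_def)
    then have "b \<in> I"
      using ij \<open>A \<subseteq> I\<close> by (auto simp: nth_append less_Suc_eq split: if_splits dest: nth_mem)
    then have "a \<notin> A" using * ij by (auto simp: maximals_def)
    then have "i < length T" using ij by (auto simp: nth_append less_Suc_eq)
    moreover have "i < j" if "j < length T"
    proof -
      have "a \<in> T ! i" "b \<in> T ! j"
        using ij that \<open>i < length T\<close> by (simp_all add: nth_append)
      moreover have "\<forall>i<length T. \<forall>j<length T. \<forall>a\<in>T ! i. \<forall>b\<in>T ! j. (a, b) \<in> R \<longrightarrow> i < j"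
        using * by (simp add: compatible_partitions_def)
      ultimately show ?thesis using that \<open>i < length T\<close> ij(5) by blast
    qed
    ultimately show ?thesis using ij(2) by (cases "j < length T") simp_all
  qed
  moreover have "ordered_set_partition (I - A) T" using * by (simp add: compatible_partitions_def)
  ultimately show "T @ [A] \<in> compatible_partitions R I"
    using * unfolding compatible_partitions_def mem_Collect_eq ordered_set_partition_snoc by blast
qed

lemma nonneg_prefixes_snoc:
  "nonneg_prefixes y (T @ [A]) \<longleftrightarrow> nonneg_prefixes y T \<and> sum y (\<Union>(set (T @ [A]))) \<ge> 0"
proof (intro iffI conjI)
  assume *: "nonneg_prefixes y (T @ [A])"
  show "sum y (\<Union>(set (T @ [A]))) \<ge> 0"
    using *[unfolded nonneg_prefixes_def, rule_format, of "Suc (length T)"] by simp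
  show "nonneg_prefixes y T" unfolding nonneg_prefixes_def
  proof
    fix i
    show "0 \<le> sum y (\<Union>(set (take i T)))"
      using *[unfolded nonneg_prefixes_def, rule_format, of "min i (length T)"]
      by (simp add: min_def split: if_splits)
  qed
next
  assume *: "nonneg_prefixes y T \<and> sum y (\<Union>(set (T @ [A]))) \<ge> 0"
  show "nonneg_prefixes y (T @ [A])" unfolding nonneg_prefixes_def
  proof
    fix i
    show "0 \<le> sum y (\<Union>(set (take i (T @ [A]))))"
      using * by (cases "i \<le> length T") (auto simp: nonneg_prefixes_def)
  qed
qed

section \<open>Cancellation over sets of maximal elements\<close>

lemma alternating_sum_Pow_eq_0:
  fixes h :: "'a set \<Rightarrow> 'b::ring_1"
  assumes "finite M" "v \<in> M" and h: "\<And>A. A \<subseteq> M - {v} \<Longrightarrow> h (insert v A) = h A"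
  shows "(\<Sum>A\<in>Pow M. (- 1) ^ card A * h A) = 0"
proof -
  let ?P = "Pow (M - {v})"
  \<comment> \<open>Subsets of \<open>M\<close> pair off as \<open>A\<close> and
    \<open>insert v A\<close>: the values of \<open>h\<close> agree and the signs are
    opposite.\<close>
  have "Pow M = ?P \<union> insert v ` ?P"
    using assms(2) by (metis Pow_insert insert_Diff)
  moreover have "?P \<inter> insert v ` ?P = {}" by auto
  ultimately have "(\<Sum>A\<in>Pow M. (- 1) ^ card A * h A) =
      (\<Sum>A\<in>?P. (- 1) ^ card A * h A) + (\<Sum>A\<in>insert v ` ?P. (- 1) ^ card A * h A)"
    using assms(1) by (simp add: sum.union_disjoint)
  also have "(\<Sum>A\<in>insert v ` ?P. (- 1) ^ card A * h A) =
      (\<Sum>A\<in>?P. (- 1) ^ card (insert v A) * h (insert v A))"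
  proof (rule sum.reindex_cong[OF _ refl refl])
    show "inj_on (insert v) ?P" by (auto simp: inj_on_def)
  qed
  also have "\<dots> = (\<Sum>A\<in>?P. - ((- 1) ^ card A * h A))"
  proof (rule sum.cong[OF refl])
    fix A assume A: "A \<in> ?P"
    then have "finite A" "v \<notin> A" using assms(1) finite_subset by auto
    then show "(- 1) ^ card (insert v A) * h (insert v A) = - ((- 1) ^ card A * h A)"
      using A h[of A] by simp
  qed
  finally show ?thesis by (simp add: sum_negf)
qed

text \<open>A maximal element precedes nothing in \<open>I\<close>, so leaving out \<open>A\<close>
  breaks no closure condition: the downsets of \<open>I - A\<close> are just the downsets of
  \<open>I\<close> that avoid \<open>A\<close>.\<close>

lemma nonneg_downsets_Diff_iff:
  assumes "A \<subseteq> maximals R I"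
  shows "nonneg_downsets R y (I - A) \<longleftrightarrow>
           (\<forall>K. downset R I K \<and> K \<inter> A = {} \<longrightarrow> sum y K \<ge> 0)"
proof -
  have "downset R (I - A) K \<longleftrightarrow> downset R I K \<and> K \<inter> A = {}" for K
    using assms unfolding downset_def maximals_def by fast
  then show ?thesis by (simp add: nonneg_downsets_def)
qed

text \<open>
  A downset \<open>c\<close> minimising the modular function \<open>sum y\<close> satisfies
  \<open>sum y (K \<inter> c) \<le> sum y K\<close> for every downset \<open>K\<close>, so only downsets inside \<open>c\<close> matter
  and any maximal element outside \<open>c\<close> can be removed freely.
\<close>
lemma exists_removable_maximal:
  fixes y :: "'a \<Rightarrow> real"
  assumes I: "finite I" "I \<noteq> {}" and "acyclic R" and yI: "sum y I \<ge> 0"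
  obtains v where "v \<in> maximals R I"
    and "\<And>A. A \<subseteq> maximals R I \<Longrightarrow>
           nonneg_downsets R y (I - insert v A) = nonneg_downsets R y (I - A)"
proof -
  let ?D = "{K. downset R I K}"
  have fin: "finite ?D"
    using I by (intro finite_subset[of ?D "Pow I"]) (auto simp: downset_def)
  have empty: "{} \<in> ?D" by (auto simp: downset_def)
  obtain c' where c': "c' \<in> ?D" "\<And>K. K \<in> ?D \<Longrightarrow> sum y c' \<le> sum y K"
    using ex_is_arg_min_if_finite[OF fin, of "sum y"] empty
    by (auto simp: is_arg_min_linorder)
  \<comment> \<open>A proper minimiser is needed to leave room for \<open>v\<close>. If
    \<open>c'\<close> is all of \<open>I\<close>, then \<open>sum y I \<ge> 0\<close> makes the
    empty set a minimiser as well.\<close>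
  define c where "c = (if c' = I then {} else c')"
  have c: "downset R I c" "c \<noteq> I" "\<And>K. downset R I K \<Longrightarrow> sum y c \<le> sum y K"
    using c' empty I(2) yI unfolding c_def by (auto intro: order_trans)
  let ?X = "I - c"
  \<comment> \<open>The element \<open>v\<close> is chosen maximal within \<open>I - c\<close>. It
    is then maximal in \<open>I\<close>, because a successor inside the downset \<open>c\<close>
    would force \<open>v\<close> into \<open>c\<close>.\<close>
  have "wf ((R \<inter> ?X \<times> ?X)\<inverse>)"
    using I(1) acyclic_subset[OF \<open>acyclic R\<close>, of "R \<inter> ?X \<times> ?X"]
    by (intro finite_acyclic_wf_converse) auto
  moreover have "?X \<noteq> {}" using c(1,2) by (auto simp: downset_def)
  ultimately obtain v where v: "v \<in> ?X" "\<And>b. (b, v) \<in> (R \<inter> ?X \<times> ?X)\<inverse> \<Longrightarrow> b \<notin> ?X"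
    by (rule wfE_min') (rule that)
  have vmax: "v \<in> maximals R I"
    using v c(1) by (auto simp: maximals_def downset_def)
  show thesis
  proof (rule that[OF vmax])
    fix A assume A: "A \<subseteq> maximals R I"
    have "sum y K \<ge> 0"
      if *: "\<And>K. downset R I K \<Longrightarrow> K \<inter> insert v A = {} \<Longrightarrow> sum y K \<ge> 0"
        and K: "downset R I K" "K \<inter> A = {}" for K
    proof -
      \<comment> \<open>Modularity gives \<open>sum y K = sum y (K \<inter> c) + (sum y (K \<union>
        c) - sum y c)\<close>. The bracket is nonnegative by minimality of \<open>c\<close>, and
        \<open>K \<inter> c\<close> avoids \<open>v\<close> because \<open>v\<close> lies outside
        \<open>c\<close>.\<close>
      have "downset R I (K \<union> c)" "downset R I (K \<inter> c)"
        using K(1) c(1) by (auto simp: downset_def)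
      moreover have "finite K" "finite c"
        using K(1) c(1) I(1) by (auto simp: downset_def intro: finite_subset)
      moreover have "K \<inter> c \<inter> insert v A = {}" using K(2) v(1) by blast
      ultimately show ?thesis
        using *[of "K \<inter> c"] c(3)[of "K \<union> c"] sum.union_inter[of K c y] by linarith
    qed
    then show "nonneg_downsets R y (I - insert v A) = nonneg_downsets R y (I - A)"
      using nonneg_downsets_Diff_iff[OF A, of y]
        nonneg_downsets_Diff_iff[of "insert v A" R I y] A vmax by auto
  qed
qed

lemma compatible_partitions_empty: "compatible_partitions R {} = {[]}"
proof -
  have "T = []" if "ordered_set_partition {} T" for T :: "'a set list"
    using that by (cases T) (auto simp: ordered_set_partition_def partition_on_def)
  then show ?thesis
    by (auto simp: compatible_partitions_def ordered_set_partition_def partition_on_def)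
qed

text \<open>The exponent adds \<open>length T\<close> instead of subtracting it; the parity is the
  same and no truncated subtraction enters the induction.\<close>

lemma sum_compatible_partitions:
  fixes y :: "'a \<Rightarrow> real"
  assumes "finite I" "acyclic R"
  shows "(\<Sum>T | T \<in> compatible_partitions R I \<and> nonneg_prefixes y T.
            (- 1) ^ (card I + length T)) = (of_bool (nonneg_downsets R y I) :: 'b::ring_1)"
  using assms(1)
proof (induction "card I" arbitrary: I rule: less_induct)
  case less
  let ?C = "\<lambda>I. {T. T \<in> compatible_partitions R I \<and> nonneg_prefixes y T}"
  have UT: "\<Union>(set T) = I" if "T \<in> compatible_partitions R I" for T
    using that by (simp add: compatible_partitions_def ordered_set_partition_def partition_on_def)
  \<comment> \<open>If the total is negative, both sides vanish, since \<open>I\<close> is itself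
    both a prefix union and a downset. Otherwise the last prefix condition is automatic, and only
    the choice of the last block remains.\<close>
  consider "I = {}" | "sum y I < 0" | "I \<noteq> {}" "sum y I \<ge> 0" by linarith
  then show ?case
  proof cases
    case 1
    then have "?C I = {[]}" "nonneg_downsets R y I"
      by (auto simp: compatible_partitions_empty nonneg_prefixes_def nonneg_downsets_def downset_def)
    then show ?thesis using 1 by simp
  next
    case 2
    have "\<not> nonneg_prefixes y T" if "T \<in> compatible_partitions R I" for T
      using UT[OF that] 2 unfolding nonneg_prefixes_def by (metis linorder_not_less take_all_iff order_refl)
    then have "?C I = {}" by blast
    moreover have "\<not> nonneg_downsets R y I"
      using 2 unfolding nonneg_downsets_def downset_def
      by (metis linorder_not_less order_refl)
    ultimately show ?thesis by (simp only: sum.empty) simp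
  next
    case 3
    let ?M = "maximals R I" and ?g = "\<lambda>I. of_bool (nonneg_downsets R y I) :: 'b"
    have finM: "finite ?M" using less.prems by (simp add: maximals_def)
    obtain v where v: "v \<in> ?M" "\<And>A. A \<subseteq> ?M \<Longrightarrow>
        nonneg_downsets R y (I - insert v A) = nonneg_downsets R y (I - A)"
      using exists_removable_maximal[OF less.prems 3(1) assms(2) 3(2)] by metis
    have C: "?C I = (\<Union>A\<in>Pow ?M - {{}}. (\<lambda>T. T @ [A]) ` ?C (I - A))"
    proof (intro set_eqI)
      fix T
      have I: "\<Union>(set T') \<union> A = I" if "T' \<in> compatible_partitions R (I - A)" "A \<subseteq> ?M" for T' A
        using that by (auto simp: compatible_partitions_def ordered_set_partition_def
            partition_on_def maximals_def)
      show "T \<in> ?C I \<longleftrightarrow> T \<in> (\<Union>A\<in>Pow ?M - {{}}. (\<lambda>T. T @ [A]) ` ?C (I - A))"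
      proof (cases T rule: rev_cases)
        case Nil
        then show ?thesis using UT[of T] 3(1) by auto
      next
        case (snoc T' A)
        then show ?thesis using I[of T' A] 3(2)
          by (auto simp: snoc_in_compatible_partitions_iff nonneg_prefixes_snoc Un_commute)
      qed
    qed
    have fin: "finite (?C J)" if "J \<subseteq> I" for J
      using finite_compatible_partitions[OF finite_subset[OF that less.prems], of R] by simp
    have "(\<Sum>T\<in>?C I. (- 1) ^ (card I + length T) :: 'b) =
        (\<Sum>A\<in>Pow ?M - {{}}. \<Sum>T\<in>(\<lambda>T. T @ [A]) ` ?C (I - A). (- 1) ^ (card I + length T))"
      unfolding C using finM fin by (intro sum.UNION_disjoint) auto
    also have "\<dots> = (\<Sum>A\<in>Pow ?M - {{}}. - ((- 1) ^ card A * ?g (I - A)))"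
    proof (rule sum.cong[OF refl])
      fix A assume A: "A \<in> Pow ?M - {{}}"
      then have AI: "A \<subseteq> I" "A \<noteq> {}" by (auto simp: maximals_def)
      have "finite A" using AI less.prems finite_subset by blast
      then have card: "card I = card A + card (I - A)"
        using AI less.prems by (simp add: card_Diff_subset card_mono)
      moreover have "card A > 0" using AI \<open>finite A\<close> by (simp add: card_gt_0_iff)
      ultimately have IH: "(\<Sum>T\<in>?C (I - A). (- 1) ^ (card (I - A) + length T)) = ?g (I - A)"
        using less.prems by (intro less.hyps) auto
      have "(\<Sum>T\<in>(\<lambda>T. T @ [A]) ` ?C (I - A). (- 1) ^ (card I + length T) :: 'b) =
          (\<Sum>T\<in>?C (I - A). (- 1) ^ (card I + length (T @ [A])))"
        by (rule sum.reindex_cong[OF _ refl refl]) (auto simp: inj_on_def)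
      \<comment> \<open>The appended block contributes the minus sign, and splitting
        \<open>card I\<close> contributes \<open>(- 1) ^ card A\<close>.\<close>
      also have "\<dots> = (\<Sum>T\<in>?C (I - A). - ((- 1) ^ card A) * (- 1) ^ (card (I - A) + length T))"
        by (simp add: card power_add mult.assoc)
      also have "\<dots> = - ((- 1) ^ card A * ?g (I - A))"
        by (simp only: IH flip: sum_distrib_left) simp
      finally show "(\<Sum>T\<in>(\<lambda>T. T @ [A]) ` ?C (I - A). (- 1) ^ (card I + length T)) =
          - ((- 1) ^ card A * ?g (I - A))" .
    qed
    \<comment> \<open>The term for the empty \<open>A\<close> is \<open>?g I\<close>. Adding and
      subtracting it completes the sum to all of \<open>Pow ?M\<close>, where the toggling of
      \<open>v\<close> applies.\<close>
    also have "\<dots> = ?g I - (\<Sum>A\<in>Pow ?M. (- 1) ^ card A * ?g (I - A))"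
      using finM by (subst sum.remove[of "Pow ?M" "{}"]) (auto simp: sum_negf)
    also have "(\<Sum>A\<in>Pow ?M. (- 1) ^ card A * ?g (I - A)) = 0"
      using finM v by (intro alternating_sum_Pow_eq_0[of _ v]) auto
    finally show ?thesis by simp
  qed
qed


section \<open>The disjoint union of chains that indexes the blocks\<close>

definition chain_atoms :: "nat \<Rightarrow> (nat \<Rightarrow> 'b list) \<Rightarrow> (nat \<times> nat) set" where
  "chain_atoms l S = (SIGMA j:{1..l}. {..<length (S j)})"

text \<open>Only covering pairs are recorded, matching \<open>shuffle_lumping\<close>, which
  compares consecutive blocks only. Longer comparisons follow by iteration along a chain.\<close>

definition chain_rel :: "((nat \<times> nat) \<times> nat \<times> nat) set" where
  "chain_rel = {((j, p), (j, Suc p)) | j p. True}"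

definition atom_block :: "(nat \<Rightarrow> 'b list) \<Rightarrow> nat \<times> nat \<Rightarrow> 'b" where
  "atom_block S q = S (fst q) ! snd q"

lemma acyclic_chain_rel: "acyclic chain_rel"
proof -
  have "wf chain_rel"
    by (rule wf_subset[OF wf_measure[of snd]]) (auto simp: chain_rel_def)
  then show ?thesis by (rule wf_acyclic)
qed

lemma finite_chain_atoms: "finite (chain_atoms l S)"
  by (simp add: chain_atoms_def)

lemma card_chain_atoms: "card (chain_atoms l S) = (\<Sum>j=1..l. length (S j))"
  by (simp add: chain_atoms_def)

text \<open>The first position missing from \<open>K\<close> on chain \<open>j\<close> is a
  threshold: membership passes down one step at a time, so no later position can belong to
  \<open>K\<close>.\<close>

lemma downset_chain_fibre:
  assumes "downset chain_rel (chain_atoms l S) K" "j \<in> {1..l}"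
  obtains k where "k \<le> length (S j)" "\<And>p. (j, p) \<in> K \<longleftrightarrow> p < k"
proof -
  define k where "k = (LEAST p. (j, p) \<notin> K)"
  have sub: "p < length (S j)" if "(j, p) \<in> K" for p
    using assms that by (auto simp: downset_def chain_atoms_def)
  have pred: "(j, p) \<in> K" if "(j, Suc p) \<in> K" for p
    using assms that sub[OF that] by (auto simp: downset_def chain_atoms_def chain_rel_def)
  have lt: "(j, p) \<in> K" if "p < k" for p
    using not_less_Least[of p "\<lambda>p. (j, p) \<notin> K"] that by (auto simp: k_def)
  have notk: "(j, k) \<notin> K"
    unfolding k_def by (rule LeastI[of _ "length (S j)"]) (use sub in blast)
  have ge: "(j, k + d) \<notin> K" for d
    by (induction d) (use notk pred in auto)
  show thesis
  proof
    show "k \<le> length (S j)"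
      unfolding k_def by (rule Least_le) (use sub in blast)
    show "(j, p) \<in> K \<longleftrightarrow> p < k" for p
      using lt[of p] ge[of "p - k"] by (cases "p < k") auto
  qed
qed

text \<open>
  The blocks of \<open>S 1, \<dots>, S l\<close> are indexed by pairs, so that a lumping becomes an
  ordered set partition of the index set whose blocks are mapped to their unions.
\<close>
locale chain_partitions =
  fixes l :: nat and J :: "nat \<Rightarrow> 'n::finite set" and S :: "nat \<Rightarrow> 'n set list"
  assumes osp: "\<And>j. j \<in> {1..l} \<Longrightarrow> ordered_set_partition (J j) (S j)"
    and disj: "disjoint_family_on J {1..l}"
    and cover: "(\<Union>j\<in>{1..l}. J j) = UNIV"
begin

abbreviation atoms :: "(nat \<times> nat) set" where
  "atoms \<equiv> chain_atoms l S"

abbreviation block :: "nat \<times> nat \<Rightarrow> 'n set" where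
  "block \<equiv> atom_block S"

definition lump :: "(nat \<times> nat) set \<Rightarrow> 'n set" where
  "lump F = \<Union>(block ` F)"

definition unlump :: "'n set \<Rightarrow> (nat \<times> nat) set" where
  "unlump A = {q \<in> atoms. block q \<subseteq> A}"

definition weight :: "real ^ 'n \<Rightarrow> nat \<times> nat \<Rightarrow> real" where
  "weight x q = coord_sum x (block q)"

lemma Union_S: "j \<in> {1..l} \<Longrightarrow> \<Union>(set (S j)) = J j"
  using osp by (auto simp: ordered_set_partition_def partition_on_def)

lemma block_subset: "q \<in> atoms \<Longrightarrow> block q \<subseteq> J (fst q)"
  using Union_S by (fastforce simp: chain_atoms_def atom_block_def dest: nth_mem)

lemma block_nonempty:
  assumes "q \<in> atoms"
  shows "block q \<noteq> {}"
proof -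
  have "block q \<in> set (S (fst q))" "fst q \<in> {1..l}"
    using assms by (auto simp: chain_atoms_def atom_block_def)
  then show ?thesis
    using osp by (fastforce simp: ordered_set_partition_def partition_on_def)
qed

text \<open>Disjointness of the \<open>J j\<close> fixes the first coordinate, then disjointness of
  the blocks within one \<open>S j\<close> fixes the second.\<close>

lemma block_unique:
  assumes q: "q \<in> atoms" "q' \<in> atoms" and a: "a \<in> block q" "a \<in> block q'"
  shows "q = q'"
proof -
  have j: "fst q \<in> {1..l}" "fst q' \<in> {1..l}"
    using q by (auto simp: chain_atoms_def)
  have "a \<in> J (fst q)" "a \<in> J (fst q')" using q a block_subset by blast+
  with disj j have eq: "fst q = fst q'"
    unfolding disjoint_family_on_def by blast
  then have "snd q = snd q'"
    using q a ordered_set_partition_nth_eq[OF osp[OF j(1)], of "snd q" "snd q'" a]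
    by (auto simp: chain_atoms_def atom_block_def)
  with eq show ?thesis by (simp add: prod_eq_iff)
qed

lemma lump_chain:
  assumes "k \<le> length (S j)"
  shows "lump ({j} \<times> {..<k}) = \<Union>(set (take k (S j)))"
proof -
  have "block ` ({j} \<times> {..<k}) = (!) (S j) ` {0..<k}"
    by (force simp: atom_block_def image_iff)
  then show ?thesis by (simp add: lump_def nth_image[OF assms])
qed

lemma lump_atoms: "lump atoms = UNIV"
proof -
  have "atoms = (\<Union>j\<in>{1..l}. {j} \<times> {..<length (S j)})"
    by (auto simp: chain_atoms_def)
  then have "lump atoms = (\<Union>j\<in>{1..l}. lump ({j} \<times> {..<length (S j)}))"
    by (auto simp: lump_def)
  also have "\<dots> = (\<Union>j\<in>{1..l}. J j)"
    by (simp add: lump_chain Union_S)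
  finally show ?thesis using cover by simp
qed

text \<open>Blocks are nonempty and pairwise disjoint, so a single point of \<open>block q\<close>
  already identifies \<open>q\<close>. This makes \<open>unlump\<close> a left inverse of
  \<open>lump\<close> on sets of atoms.\<close>

lemma block_subset_lump_iff:
  assumes "q \<in> atoms" "F \<subseteq> atoms"
  shows "block q \<subseteq> lump F \<longleftrightarrow> q \<in> F"
proof
  assume "block q \<subseteq> lump F"
  moreover obtain a where "a \<in> block q" using block_nonempty[OF assms(1)] by blast
  ultimately obtain q' where "q' \<in> F" "a \<in> block q'" by (auto simp: lump_def)
  then show "q \<in> F" using block_unique[of q q' a] assms \<open>a \<in> block q\<close> by blast
qed (auto simp: lump_def)

lemma unlump_lump: "F \<subseteq> atoms \<Longrightarrow> unlump (lump F) = F"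
  unfolding unlump_def using block_subset_lump_iff by blast

lemma coord_sum_lump:
  assumes "F \<subseteq> atoms"
  shows "coord_sum x (lump F) = sum (weight x) F"
  unfolding coord_sum_def lump_def weight_def
proof (rule sum.UNION_disjoint)
  show "finite F" using assms finite_chain_atoms finite_subset by blast
  show "\<forall>q\<in>F. \<forall>q'\<in>F. q \<noteq> q' \<longrightarrow> block q \<inter> block q' = {}"
    using assms block_unique by blast
qed simp

section \<open>The bijection between compatible partitions of the atoms and shuffle-lumpings\<close>

lemma block_index_map_lump:
  assumes Fs: "ordered_set_partition atoms Fs" and a: "a < length Fs" "q \<in> Fs ! a"
  shows "block_index (map lump Fs) (block q) = a"
proof -
  have sub: "Fs ! b \<subseteq> atoms" if "b < length Fs" for b
    using Fs nth_mem[OF that] by (auto simp: ordered_set_partition_def partition_on_def)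
  then have q: "q \<in> atoms" using a by blast
  \<comment> \<open>Containment of \<open>block q\<close> in a lump is membership of
    \<open>q\<close>, so \<open>block_index\<close> searches for the unique position of
    \<open>q\<close> in \<open>Fs\<close>.\<close>
  show ?thesis unfolding block_index_def
  proof (rule the_equality)
    show "a < length (map lump Fs) \<and> block q \<subseteq> map lump Fs ! a"
      using a block_subset_lump_iff[OF q sub] by simp
    fix b assume "b < length (map lump Fs) \<and> block q \<subseteq> map lump Fs ! b"
    then have "b < length Fs" "q \<in> Fs ! b"
      using block_subset_lump_iff[OF q sub] by auto
    then show "b = a" using ordered_set_partition_nth_eq[OF Fs _ a(1)] a(2) by blast
  qed
qed

lemma map_lump_ordered_set_partition:
  assumes Fs: "ordered_set_partition atoms Fs"
  shows "ordered_set_partition UNIV (map lump Fs)"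
proof -
  have part: "distinct Fs" "\<Union>(set Fs) = atoms" "disjoint (set Fs)" "{} \<notin> set Fs"
    using Fs by (auto simp: ordered_set_partition_def partition_on_def)
  have sub: "F \<subseteq> atoms" if "F \<in> set Fs" for F using part that by blast
  have "inj_on lump (set Fs)"
    using sub unlump_lump by (metis inj_onI)
  moreover have "\<Union>(lump ` set Fs) = lump (\<Union>(set Fs))"
    by (auto simp: lump_def)
  moreover have "{} \<noteq> lump F" if F: "F \<in> set Fs" for F
  proof -
    have "F \<noteq> {}" using part F by metis
    then obtain q where "q \<in> F" by blast
    then show ?thesis
      using block_nonempty[of q] sub[OF F] by (auto simp: lump_def)
  qed
  then have "{} \<notin> lump ` set Fs" by blast
  moreover have "disjoint (lump ` set Fs)"
  proof (rule disjointI)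
    fix A B assume AB: "A \<in> lump ` set Fs" "B \<in> lump ` set Fs" "A \<noteq> B"
    then obtain F G where FG: "F \<in> set Fs" "G \<in> set Fs" "A = lump F" "B = lump G" by blast
    with AB part have "F \<inter> G = {}" by (metis disjointD)
    then show "A \<inter> B = {}"
      using FG sub block_unique unfolding lump_def by blast
  qed
  ultimately show ?thesis
    using part lump_atoms
    by (auto simp: ordered_set_partition_def partition_on_def distinct_map)
qed

text \<open>Consecutive blocks of one \<open>S j\<close> are \<open>chain_rel\<close>-related atoms,
  and \<open>block_index\<close> reads off their positions in \<open>Fs\<close>, so compatibility
  yields the required inequalities.\<close>

lemma map_lump_shuffle_lumping:
  assumes "Fs \<in> compatible_partitions chain_rel atoms"
  shows "shuffle_lumping l S (map lump Fs)"
proof -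
  have Fs: "ordered_set_partition atoms Fs"
    and less: "\<And>i j a b. i < length Fs \<Longrightarrow> j < length Fs \<Longrightarrow> a \<in> Fs ! i \<Longrightarrow> b \<in> Fs ! j \<Longrightarrow>
      (a, b) \<in> chain_rel \<Longrightarrow> i < j"
    using assms by (auto simp: compatible_partitions_def)
  have U: "\<Union>(set Fs) = atoms"
    using Fs by (auto simp: ordered_set_partition_def partition_on_def)
  have "\<exists>G. G \<subseteq> (\<Union>j\<in>{1..l}. set (S j)) \<and> A = \<Union>G" if A: "A \<in> set (map lump Fs)" for A
  proof -
    obtain F where "F \<in> set Fs" "A = lump F" using A by auto
    then have F: "F \<in> set Fs" "A = \<Union>(block ` F)" by (simp_all add: lump_def)
    have "block q \<in> (\<Union>j\<in>{1..l}. set (S j))" if "q \<in> atoms" for q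
    proof
      show "fst q \<in> {1..l}" "block q \<in> set (S (fst q))"
        using that by (auto simp: atom_block_def chain_atoms_def)
    qed
    moreover have "F \<subseteq> atoms" using F(1) U by blast
    ultimately have "block ` F \<subseteq> (\<Union>j\<in>{1..l}. set (S j))" by blast
    with F(2) show ?thesis by (intro exI[of _ "block ` F"] conjI)
  qed
  moreover have "block_index (map lump Fs) (S j ! i) < block_index (map lump Fs) (S j ! Suc i)"
    if ji: "j \<in> {1..l}" "Suc i < length (S j)" for j i
  proof -
    have "(j, i) \<in> atoms" "(j, Suc i) \<in> atoms"
      using ji by (auto simp: chain_atoms_def)
    then obtain a b where ab: "a < length Fs" "(j, i) \<in> Fs ! a" "b < length Fs" "(j, Suc i) \<in> Fs ! b"
      using U by (metis UnionE in_set_conv_nth)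
    then have "a < b" using less[of a b] by (auto simp: chain_rel_def)
    then show ?thesis
      using block_index_map_lump[OF Fs ab(1,2)] block_index_map_lump[OF Fs ab(3,4)]
      by (simp add: atom_block_def)
  qed
  ultimately show ?thesis
    using map_lump_ordered_set_partition[OF Fs] by (auto simp: shuffle_lumping_def)
qed

lemma map_unlump:
  assumes T: "shuffle_lumping l S T"
  shows "map unlump T \<in> compatible_partitions chain_rel atoms"
    and "map lump (map unlump T) = T"
proof -
  have part: "distinct T" "\<Union>(set T) = UNIV" "disjoint (set T)" "{} \<notin> set T"
    using T by (auto simp: shuffle_lumping_def ordered_set_partition_def partition_on_def)
  \<comment> \<open>A block of \<open>T\<close> is a union of a set of blocks; pulling that set back
    to indices presents it as a lump, which \<open>unlump\<close> then inverts.\<close>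
  have rep: "\<exists>F\<subseteq>atoms. A = lump F" if A: "A \<in> set T" for A
  proof -
    obtain G where G: "G \<subseteq> (\<Union>j\<in>{1..l}. set (S j))" "A = \<Union>G"
      using T A by (auto simp: shuffle_lumping_def)
    have "(\<Union>j\<in>{1..l}. set (S j)) \<subseteq> block ` atoms"
    proof
      fix B assume "B \<in> (\<Union>j\<in>{1..l}. set (S j))"
      then obtain j p where "j \<in> {1..l}" "p < length (S j)" "B = S j ! p"
        by (auto simp: in_set_conv_nth)
      then have "(j, p) \<in> atoms" "B = block (j, p)"
        by (auto simp: chain_atoms_def atom_block_def)
      then show "B \<in> block ` atoms" by blast
    qed
    then obtain F where "F \<subseteq> atoms" "G = block ` F"
      using G(1) by (meson order_trans subset_imageE)
    then show ?thesis using G(2) by (auto simp: lump_def)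
  qed
  have lu: "lump (unlump A) = A" if "A \<in> set T" for A
    using rep[OF that] unlump_lump by auto
  show lumpT: "map lump (map unlump T) = T"
    using lu by (simp add: map_idI)
  have "inj_on unlump (set T)" using lu by (metis inj_onI)
  moreover have "unlump A \<noteq> {}" if "A \<in> set T" for A
    using lu[OF that] part(4) that by (auto simp: lump_def)
  moreover have "\<Union>(unlump ` set T) = atoms"
  proof
    show "atoms \<subseteq> \<Union>(unlump ` set T)"
    proof
      fix q assume q: "q \<in> atoms"
      then obtain a where a: "a \<in> block q" using block_nonempty by blast
      then obtain A where A: "A \<in> set T" "a \<in> A" using part(2) by blast
      then have "a \<in> lump (unlump A)" using lu by blast
      then obtain q' where "q' \<in> unlump A" "a \<in> block q'"
        unfolding lump_def by blast
      then show "q \<in> \<Union>(unlump ` set T)"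
        using block_unique[OF q _ a, of q'] A by (auto simp: unlump_def)
    qed
  qed (auto simp: unlump_def)
  moreover have "disjoint (unlump ` set T)"
  proof (rule disjointI)
    fix F G assume "F \<in> unlump ` set T" "G \<in> unlump ` set T" "F \<noteq> G"
    then obtain A B where AB: "A \<in> set T" "B \<in> set T" "F = unlump A" "G = unlump B" "A \<noteq> B"
      by blast
    then have "A \<inter> B = {}" using part(3) by (metis disjointD)
    then show "F \<inter> G = {}"
      using AB block_nonempty unfolding unlump_def by blast
  qed
  ultimately have Fs: "ordered_set_partition atoms (map unlump T)"
    using part(1) by (auto simp: ordered_set_partition_def partition_on_def distinct_map)
  have "i < j" if ij: "i < length T" "j < length T" "a \<in> unlump (T ! i)" "b \<in> unlump (T ! j)"
    "(a, b) \<in> chain_rel" for i j a b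
  proof -
    obtain c p where ab: "a = (c, p)" "b = (c, Suc p)" using ij by (auto simp: chain_rel_def)
    have "b \<in> atoms" using ij by (simp add: unlump_def)
    then have "c \<in> {1..l}" "Suc p < length (S c)" by (auto simp: ab chain_atoms_def)
    then have "block_index T (block a) < block_index T (block b)"
      using T by (auto simp: shuffle_lumping_def ab atom_block_def)
    moreover have "block_index T (block a) = i" "block_index T (block b) = j"
      using block_index_map_lump[OF Fs, of i a] block_index_map_lump[OF Fs, of j b] ij
      by (simp_all only: lumpT length_map nth_map)
    ultimately show ?thesis by simp
  qed
  then show "map unlump T \<in> compatible_partitions chain_rel atoms"
    using Fs by (auto simp: compatible_partitions_def)
qed

section \<open>Membership in a plate and in the Minkowski sum\<close>

lemma mem_plate_map_lump_iff:
  assumes Fs: "ordered_set_partition atoms Fs"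
  shows "x \<in> plate (map lump Fs) \<longleftrightarrow> coord_sum x UNIV = 0 \<and> nonneg_prefixes (weight x) Fs"
proof -
  have U: "\<Union>(set Fs) = atoms" "\<Union>(set (map lump Fs)) = UNIV"
    using Fs map_lump_ordered_set_partition[OF Fs]
    by (auto simp: ordered_set_partition_def partition_on_def)
  have prefix: "coord_sum x (\<Union>(set (take i (map lump Fs)))) = sum (weight x) (\<Union>(set (take i Fs)))" for i
  proof -
    have "\<Union>(set (take i (map lump Fs))) = lump (\<Union>(set (take i Fs)))"
      by (auto simp: take_map lump_def)
    moreover have "\<Union>(set (take i Fs)) \<subseteq> atoms"
      using U(1) by (auto dest: in_set_takeD)
    ultimately show ?thesis by (simp add: coord_sum_lump)
  qed
  have total: "sum (weight x) atoms = coord_sum x UNIV"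
    using coord_sum_lump[of atoms x] lump_atoms by simp
  \<comment> \<open>\<open>plate\<close> tests only the proper nonempty prefixes. Once the total is
    zero, the remaining indices in \<open>nonneg_prefixes\<close> give sums equal to zero.\<close>
  have "nonneg_prefixes (weight x) Fs \<longleftrightarrow>
      (\<forall>i\<in>{1..<length Fs}. sum (weight x) (\<Union>(set (take i Fs))) \<ge> 0)"
    if "coord_sum x UNIV = 0"
  proof
    assume *: "\<forall>i\<in>{1..<length Fs}. sum (weight x) (\<Union>(set (take i Fs))) \<ge> 0"
    have "sum (weight x) (\<Union>(set (take i Fs))) \<ge> 0" for i
    proof -
      consider "i = 0" | "i \<in> {1..<length Fs}" | "i \<ge> length Fs" by fastforce
      then show ?thesis
        using * U(1) total that by cases auto
    qed
    then show "nonneg_prefixes (weight x) Fs" by (simp add: nonneg_prefixes_def)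
  qed (simp add: nonneg_prefixes_def)
  then show ?thesis
    unfolding plate_def mem_Collect_eq U(2) prefix length_map by auto
qed

text \<open>The summands are supported on the disjoint sets \<open>J j\<close>, so the decomposition
  of \<open>x\<close> is forced: the \<open>j\<close>-th summand is the restriction of
  \<open>x\<close> to \<open>J j\<close>, and the plate conditions separate.\<close>

lemma mem_sum_plates_iff:
  "x \<in> (\<Sum>j=1..l. plate (S j)) \<longleftrightarrow>
     (\<forall>j\<in>{1..l}. (\<forall>i\<in>{1..<length (S j)}. coord_sum x (\<Union>(set (take i (S j)))) \<ge> 0) \<and>
                  coord_sum x (J j) = 0)"
  (is "_ \<longleftrightarrow> ?R")
proof
  assume "x \<in> (\<Sum>j=1..l. plate (S j))"
  then obtain s where s: "x = sum s {1..l}" "\<And>j. j \<in> {1..l} \<Longrightarrow> s j \<in> plate (S j)"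
    by (auto simp: set_sum_alt)
  have eq: "coord_sum x A = coord_sum (s j) A" if j: "j \<in> {1..l}" "A \<subseteq> J j" for j A
  proof -
    have "x $ a = s j $ a" if a: "a \<in> A" for a
    proof -
      have "s i $ a = 0" if i: "i \<in> {1..l} - {j}" for i
      proof -
        have "J i \<inter> J j = {}" using disj i j(1) by (auto simp: disjoint_family_on_def)
        then have "a \<notin> \<Union>(set (S i))" using a j(2) i Union_S[of i] by blast
        then show ?thesis using s(2)[of i] i by (auto simp: plate_def)
      qed
      then have "(\<Sum>i\<in>{1..l} - {j}. s i $ a) = 0" by (intro sum.neutral) blast
      then show ?thesis
        using s(1) j(1) sum.remove[of "{1..l}" j "\<lambda>i. s i $ a"] by simp
    qed
    then show ?thesis by (simp add: coord_sum_def)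
  qed
  show ?R
  proof
    fix j assume j: "j \<in> {1..l}"
    have "\<Union>(set (take i (S j))) \<subseteq> J j" for i
      using Union_S[OF j] by (auto dest: in_set_takeD)
    then show "(\<forall>i\<in>{1..<length (S j)}. coord_sum x (\<Union>(set (take i (S j)))) \<ge> 0) \<and>
        coord_sum x (J j) = 0"
      using s(2)[OF j] eq[OF j] Union_S[OF j] by (simp add: plate_def)
  qed
next
  assume R: ?R
  define s :: "nat \<Rightarrow> real ^ 'n" where "s j = (\<chi> a. if a \<in> J j then x $ a else 0)" for j
  have eq: "coord_sum (s j) A = coord_sum x A" if "A \<subseteq> J j" for j A
    unfolding coord_sum_def s_def using that by (intro sum.cong) auto
  have "s j \<in> plate (S j)" if j: "j \<in> {1..l}" for j
  proof -
    have "\<Union>(set (take i (S j))) \<subseteq> J j" for i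
      using Union_S[OF j] by (auto dest: in_set_takeD)
    then show ?thesis
      using R j eq[of _ j] unfolding plate_def mem_Collect_eq Union_S[OF j] by (simp add: s_def)
  qed
  moreover have "x = sum s {1..l}"
  proof (rule vec_eq_iff[THEN iffD2], rule allI)
    fix a
    obtain j where j: "j \<in> {1..l}" "a \<in> J j" using cover by blast
    have "s i $ a = 0" if "i \<in> {1..l} - {j}" for i
    proof -
      have "a \<notin> J i" using disj j that unfolding disjoint_family_on_def by blast
      then show ?thesis by (simp add: s_def)
    qed
    then have "(\<Sum>i\<in>{1..l} - {j}. s i $ a) = 0" by (intro sum.neutral) blast
    then have "(\<Sum>i\<in>{1..l}. s i $ a) = s j $ a"
      using sum.remove[of "{1..l}" j "\<lambda>i. s i $ a"] j(1) by simp
    then show "x $ a = sum s {1..l} $ a"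
      using j by (simp add: s_def)
  qed
  ultimately show "x \<in> (\<Sum>j=1..l. plate (S j))"
    by (auto simp: set_sum_alt)
qed

text \<open>A downset is a union of one initial segment from each chain, so its weight is the sum of
  the corresponding \<open>c j k\<close>. Nonnegativity on all downsets thus reduces to
  nonnegativity of each \<open>c j k\<close>.\<close>

lemma mem_sum_plates_iff_nonneg_downsets:
  "x \<in> (\<Sum>j=1..l. plate (S j)) \<longleftrightarrow>
     coord_sum x UNIV = 0 \<and> nonneg_downsets chain_rel (weight x) atoms"
proof -
  define c where "c j k = sum (weight x) ({j} \<times> {..<k})" for j k
  have c: "coord_sum x (\<Union>(set (take k (S j)))) = c j k" if "j \<in> {1..l}" "k \<le> length (S j)" for j k
  proof -
    have "{j} \<times> {..<k} \<subseteq> atoms" using that by (auto simp: chain_atoms_def)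
    from coord_sum_lump[OF this, of x] show ?thesis
      by (simp add: c_def lump_chain[OF that(2)])
  qed
  have cJ: "coord_sum x (J j) = c j (length (S j))" if "j \<in> {1..l}" for j
    using c[OF that order_refl] Union_S[OF that] by simp
  have split: "sum (weight x) K = (\<Sum>j=1..l. c j (k j))"
    if "K = (SIGMA j:{1..l}. {..<k j})" for K k
  proof -
    have "sum (weight x) K = (\<Sum>j=1..l. \<Sum>p<k j. weight x (j, p))"
      by (simp add: that sum.Sigma)
    also have "\<dots> = (\<Sum>j=1..l. c j (k j))"
    proof (rule sum.cong[OF refl])
      show "(\<Sum>p<k j. weight x (j, p)) = c j (k j)" for j
        using sum.cartesian_product[of "\<lambda>j p. weight x (j, p)" "{..<k j}" "{j}"]
        by (simp add: c_def)
    qed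
    finally show ?thesis .
  qed
  have total: "coord_sum x UNIV = (\<Sum>j=1..l. c j (length (S j)))"
    using split[of atoms "\<lambda>j. length (S j)"] coord_sum_lump[of atoms x] lump_atoms
    by (simp add: chain_atoms_def)
  have "x \<in> (\<Sum>j=1..l. plate (S j)) \<longleftrightarrow>
      (\<forall>j\<in>{1..l}. (\<forall>i\<in>{1..<length (S j)}. c j i \<ge> 0) \<and> c j (length (S j)) = 0)"
    unfolding mem_sum_plates_iff using c cJ by auto
  also have "\<dots> \<longleftrightarrow> coord_sum x UNIV = 0 \<and> nonneg_downsets chain_rel (weight x) atoms"
  proof (intro iffI conjI)
    assume *: "\<forall>j\<in>{1..l}. (\<forall>i\<in>{1..<length (S j)}. c j i \<ge> 0) \<and> c j (length (S j)) = 0"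
    then show "coord_sum x UNIV = 0" by (simp add: total)
    have nonneg: "c j k \<ge> 0" if jk: "j \<in> {1..l}" "k \<le> length (S j)" for j k
    proof -
      consider "k = 0" | "k \<in> {1..<length (S j)}" | "k = length (S j)" using jk by fastforce
      then show ?thesis
      proof cases
        case 1
        then show ?thesis by (simp add: c_def)
      next
        case 2
        then show ?thesis using * jk(1) by blast
      next
        case 3
        then show ?thesis using * jk(1) by simp
      qed
    qed
    show "nonneg_downsets chain_rel (weight x) atoms" unfolding nonneg_downsets_def
    proof (intro allI impI)
      fix K assume K: "downset chain_rel atoms K"
      have "\<exists>k\<le>length (S j). \<forall>p. (j, p) \<in> K \<longleftrightarrow> p < k" if "j \<in> {1..l}" for j
        using downset_chain_fibre[OF K that] by metis
      then obtain k where k: "\<And>j. j \<in> {1..l} \<Longrightarrow> k j \<le> length (S j) \<and> (\<forall>p. (j, p) \<in> K \<longleftrightarrow> p < k j)"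
        by metis
      have "(j, p) \<in> K \<longleftrightarrow> j \<in> {1..l} \<and> p < k j" for j p
      proof (cases "j \<in> {1..l}")
        case False
        then show ?thesis using K by (auto simp: downset_def chain_atoms_def)
      qed (use k in blast)
      then have "K = (SIGMA j:{1..l}. {..<k j})"
        by (simp only: set_eq_iff split_paired_All mem_Sigma_iff lessThan_iff simp_thms)
      from split[OF this] show "sum (weight x) K \<ge> 0"
        using k nonneg by (simp only: sum_nonneg)
    qed
  next
    assume *: "coord_sum x UNIV = 0 \<and> nonneg_downsets chain_rel (weight x) atoms"
    have nonneg: "c j k \<ge> 0" if "j \<in> {1..l}" "k \<le> length (S j)" for j k
    proof -
      have "downset chain_rel atoms ({j} \<times> {..<k})"
        using that by (auto simp: downset_def chain_atoms_def chain_rel_def)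
      then show ?thesis using * by (auto simp: c_def nonneg_downsets_def)
    qed
    \<comment> \<open>Each full chain is a downset, so its weight is nonnegative; these weights add
      up to zero, hence each one vanishes.\<close>
    then have "\<forall>j\<in>{1..l}. c j (length (S j)) = 0"
      using * total sum_nonneg_eq_0_iff[of "{1..l}" "\<lambda>j. c j (length (S j))"] by simp
    then show "\<forall>j\<in>{1..l}. (\<forall>i\<in>{1..<length (S j)}. c j i \<ge> 0) \<and> c j (length (S j)) = 0"
      using nonneg by simp
  qed
  finally show ?thesis .
qed

section \<open>Transport of the alternating sum to plates, and membership in the span\<close>

lemma indicator_sum_plates:
  "(indicator (\<Sum>j=1..l. plate (S j)) x :: complex) =
     (\<Sum>\<pi> | shuffle_lumping l S \<pi>. (- 1) ^ ((\<Sum>j=1..l. length (S j)) - length \<pi>) * plate_fun \<pi> x)"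
proof -
  let ?m = "\<Sum>j=1..l. length (S j)" and ?C = "compatible_partitions chain_rel atoms"
  have osp': "ordered_set_partition atoms Fs" if "Fs \<in> ?C" for Fs
    using that by (simp add: compatible_partitions_def)
  have ul: "map unlump (map lump Fs) = Fs" if "Fs \<in> ?C" for Fs
  proof -
    have "F \<subseteq> atoms" if "F \<in> set Fs" for F
      using osp'[OF \<open>Fs \<in> ?C\<close>] that by (auto simp: ordered_set_partition_def partition_on_def)
    then show ?thesis by (simp add: map_idI unlump_lump)
  qed
  have fin: "finite ?C" by (intro finite_compatible_partitions finite_chain_atoms)
  have "(\<Sum>\<pi> | shuffle_lumping l S \<pi>. (- 1) ^ (?m - length \<pi>) * plate_fun \<pi> x) =
      (\<Sum>Fs\<in>?C. (- 1) ^ (?m - length Fs) * plate_fun (map lump Fs) x)"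
    by (rule sum.reindex_bij_witness[of _ "map lump" "map unlump"])
       (use ul map_unlump map_lump_shuffle_lumping in auto)
  also have "\<dots> = (\<Sum>Fs\<in>?C. if nonneg_prefixes (weight x) Fs
      then of_bool (coord_sum x UNIV = 0) * (- 1) ^ (card atoms + length Fs) else 0)"
  proof (rule sum.cong[OF refl])
    fix Fs assume Fs: "Fs \<in> ?C"
    have "length Fs \<le> ?m"
      using shuffle_lumping_length_le[OF map_lump_shuffle_lumping[OF Fs]] by simp
    \<comment> \<open>As \<open>length Fs \<le> ?m\<close>, the difference is not truncated and has
      the parity of the sum.\<close>
    then have "(- 1) ^ (?m - length Fs) = ((- 1) ^ (card atoms + length Fs) :: complex)"
      by (intro minus_one_power_iff[THEN trans] minus_one_power_iff[THEN trans, symmetric])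
         (simp add: card_chain_atoms even_diff_nat)
    then show "(- 1) ^ (?m - length Fs) * plate_fun (map lump Fs) x =
        (if nonneg_prefixes (weight x) Fs
         then of_bool (coord_sum x UNIV = 0) * (- 1) ^ (card atoms + length Fs) else 0)"
      by (auto simp: plate_fun_def mem_plate_map_lump_iff[OF osp'[OF Fs]] indicator_def)
  qed
  also have "\<dots> = of_bool (coord_sum x UNIV = 0) *
      (\<Sum>Fs | Fs \<in> ?C \<and> nonneg_prefixes (weight x) Fs. (- 1) ^ (card atoms + length Fs))"
    using fin by (simp add: sum.If_cases sum_distrib_left Int_def)
  also have "\<dots> = of_bool (coord_sum x UNIV = 0) * of_bool (nonneg_downsets chain_rel (weight x) atoms)"
    by (simp only: sum_compatible_partitions[OF finite_chain_atoms acyclic_chain_rel])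
  also have "\<dots> = indicator (\<Sum>j=1..l. plate (S j)) x"
    using mem_sum_plates_iff_nonneg_downsets[of x] by (auto simp: indicator_def)
  finally show ?thesis ..
qed

end

lemma sum_plate_funs_in_plate_space:
  assumes "\<And>\<pi>. \<pi> \<in> X \<Longrightarrow> ordered_set_partition UNIV \<pi>"
  shows "(\<lambda>x. \<Sum>\<pi>\<in>X. c \<pi> * plate_fun \<pi> x) \<in> (plate_space :: (real ^ 'n::finite \<Rightarrow> complex) set)"
proof -
  interpret module "\<lambda>(c :: complex) (f :: real ^ 'n \<Rightarrow> complex) x. c * f x"
    by unfold_locales (auto simp: fun_eq_iff algebra_simps)
  have "(\<Sum>\<pi>\<in>X. (\<lambda>x. c \<pi> * plate_fun \<pi> x)) \<in> plate_space"
    unfolding plate_space_def using assms by (intro span_sum span_scale span_base) blast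
  \<comment> \<open>Span closure speaks of sums of functions, the goal of a pointwise sum. For
    infinite \<open>X\<close> both are zero by convention.\<close>
  moreover have "(\<Sum>\<pi>\<in>X. (\<lambda>x. c \<pi> * plate_fun \<pi> x)) = (\<lambda>x. \<Sum>\<pi>\<in>X. c \<pi> * plate_fun \<pi> x)"
    by (induction X rule: infinite_finite_induct) (auto simp: fun_eq_iff)
  ultimately show ?thesis by simp
qed

theorem theorem3p11:
  fixes l m :: nat
    and J :: "nat \<Rightarrow> 'n::finite set"
    and S :: "nat \<Rightarrow> 'n set list"
  assumes "\<And>j. j \<in> {1..l} \<Longrightarrow> ordered_set_partition (J j) (S j)"
    and "disjoint_family_on J {1..l}"
    and "(\<Union>j\<in>{1..l}. J j) = UNIV"
    and "m = (\<Sum>j=1..l. length (S j))"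
  shows "(indicator (\<Sum>j=1..l. plate (S j)) :: real ^ 'n \<Rightarrow> complex) =
           (\<lambda>x. \<Sum>\<pi> | shuffle_lumping l S \<pi>. (- 1) ^ (m - length \<pi>) * plate_fun \<pi> x) \<and>
         (indicator (\<Sum>j=1..l. plate (S j)) :: real ^ 'n \<Rightarrow> complex) \<in> plate_space"
proof -
  interpret chain_partitions l J S
    using assms(1-3) by unfold_locales
  have eq: "(indicator (\<Sum>j=1..l. plate (S j)) :: real ^ 'n \<Rightarrow> complex) =
      (\<lambda>x. \<Sum>\<pi> | shuffle_lumping l S \<pi>. (- 1) ^ (m - length \<pi>) * plate_fun \<pi> x)"
    using indicator_sum_plates assms(4) by (simp add: fun_eq_iff)
  moreover have "\<dots> \<in> plate_space"
    by (rule sum_plate_funs_in_plate_space) (simp add: shuffle_lumping_def)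
  ultimately show ?thesis by simp
qed

end
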